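(* For each pair $(z_1,z_2)\in\mathbb{R}^d\times\mathbb{R}^d$ let $p(\cdot\mid z_1,z_2)$ be a probability density on $\mathbb{R}^d$ (a data-dependent spectral distribution). Suppose that there are real-valued functions $r$ on $\mathbb{R}^d$ and $s$ on $\mathbb{R}^d\times\mathbb{R}^d$ such that $$p(\omega\mid z_1,z_2)=r(\omega)\,s(\omega,z_1)\,s(\omega,z_2)\quad\text{for all }\omega,z_1,z_2\in\mathbb{R}^d,$$ with $r(\omega)\ge 0$ for all $\omega$ and $s(\omega,z_1)s(\omega,z_2)\ge 0$ for all $(\omega,z_1,z_2)$. Then the kernel $$\kappa(z_1,z_2)=\int_{\mathbb{R}^d}p(\omega\mid z_1,z_2)\,e^{j\omega^{\top}(z_1-z_2)}\,d\omega$$ is positive definite.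
   Context: Here $j$ is the imaginary unit, $j^2=-1$. A kernel $\kappa$ on $\mathbb{R}^d\times\mathbb{R}^d$ is called positive definite if for every $n\ge 1$, all $c_1,\dots,c_n\in\mathbb{R}$ and all $z_1,\dots,z_n\in\mathbb{R}^d$ one has $\sum_{i=1}^n\sum_{k=1}^n c_ic_k\,\kappa(z_i,z_k)\ge 0$ (strict inequality is not required). *)

theory Defs
  imports "HOL-Analysis.Analysis"
begin

text \<open>Densities are taken with respect to Lebesgue measure and are only required to be
  Lebesgue measurable, which includes the Borel measurable ones.\<close>

definition prob_density :: "(real ^ 'd \<Rightarrow> real) \<Rightarrow> bool" where
  "prob_density f \<longleftrightarrow>
     (\<forall>\<omega>. 0 \<le> f \<omega>) \<and> integrable lebesgue f \<and> (LINT \<omega>|lebesgue. f \<omega>) = 1"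

text \<open>For a complex-valued kernel, \<open>\<ge> 0\<close> means that the sum is a nonnegative real number,
  so a vanishing imaginary part is part of the claim. The points are not required to be
  distinct.\<close>

definition positive_definite_kernel :: "(real ^ 'd \<Rightarrow> real ^ 'd \<Rightarrow> complex) \<Rightarrow> bool" where
  "positive_definite_kernel \<kappa> \<longleftrightarrow>
     (\<forall>n\<ge>1. \<forall>(c :: nat \<Rightarrow> real) (z :: nat \<Rightarrow> real ^ 'd).
        (\<Sum>i=1..n. \<Sum>k=1..n. complex_of_real (c i) * complex_of_real (c k) * \<kappa> (z i) (z k))
          \<in> \<real>\<^sub>\<ge>\<^sub>0)"

text \<open>The argument \<open>p \<omega> z1 z2\<close> stands for \<open>p(\<omega> | z1, z2)\<close>.\<close>

definition spectral_kernel ::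
  "(real ^ 'd \<Rightarrow> real ^ 'd \<Rightarrow> real ^ 'd \<Rightarrow> real) \<Rightarrow> real ^ 'd \<Rightarrow> real ^ 'd \<Rightarrow> complex" where
  "spectral_kernel p z1 z2 =
     (LINT \<omega>|lebesgue.
        complex_of_real (p \<omega> z1 z2) * exp (\<i> * complex_of_real (\<omega> \<bullet> (z1 - z2))))"

end

theory Submission
  imports Defs
begin

text \<open>With \<open>g \<omega> = (\<Sum>i. c i * s \<omega> (z i) * exp (\<i> * (\<omega> \<bullet> z i)))\<close>, the factorisation of \<open>p\<close> turns
  the quadratic form into the integral of \<open>r \<omega> * \<bar>g \<omega>\<bar>\<^sup>2\<close>.\<close>

text \<open>The exponential is continuous in \<omega> and has modulus 1, so the product is
  measurable and dominated by \<open>f\<close>. This is what allows finite sums to be moved under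
  the integral later.\<close>

lemma integrable_mult_exp_inner:
  fixes f :: "real ^ 'd \<Rightarrow> real" and v :: "real ^ 'd"
  assumes f: "integrable lebesgue f"
  shows "integrable lebesgue (\<lambda>\<omega>. complex_of_real (f \<omega>) * exp (\<i> * complex_of_real (\<omega> \<bullet> v)))"
proof (rule Bochner_Integration.integrable_bound[OF f])
  have "(\<lambda>\<omega>. exp (\<i> * complex_of_real (\<omega> \<bullet> v))) \<in> borel_measurable borel"
    by (intro borel_measurable_continuous_onI continuous_intros)
  then have "(\<lambda>\<omega>. exp (\<i> * complex_of_real (\<omega> \<bullet> v))) \<in> borel_measurable lebesgue"
    by (intro measurable_completion) simp
  then show "(\<lambda>\<omega>. complex_of_real (f \<omega>) * exp (\<i> * complex_of_real (\<omega> \<bullet> v)))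
      \<in> borel_measurable lebesgue"
    using f by measurable
qed (simp add: norm_mult)

text \<open>The double sum factors as a sum times its own conjugate. Applied for each fixed
  \<omega>, this shows both realness and sign of the integrand.\<close>

lemma double_sum_cnj_eq_norm_square:
  fixes a :: "'i \<Rightarrow> complex"
  shows "(\<Sum>i\<in>I. \<Sum>k\<in>I. a i * cnj (a k)) = complex_of_real ((cmod (\<Sum>i\<in>I. a i))\<^sup>2)"
  proof -
  have "(\<Sum>i\<in>I. \<Sum>k\<in>I. a i * cnj (a k)) = (\<Sum>i\<in>I. a i) * cnj (\<Sum>i\<in>I. a i)"
    by (simp only: sum_product cnj_sum)
  then show ?thesis
    by (simp only: complex_norm_square)
qed

theorem theorem2:
  fixes p :: "real ^ 'd \<Rightarrow> real ^ 'd \<Rightarrow> real ^ 'd \<Rightarrow> real"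
    and r :: "real ^ 'd \<Rightarrow> real"
    and s :: "real ^ 'd \<Rightarrow> real ^ 'd \<Rightarrow> real"
  assumes density: "\<And>z1 z2. prob_density (\<lambda>\<omega>. p \<omega> z1 z2)"
    and factor: "\<And>\<omega> z1 z2. p \<omega> z1 z2 = r \<omega> * s \<omega> z1 * s \<omega> z2"
    and r_nonneg: "\<And>\<omega>. 0 \<le> r \<omega>"
    and s_nonneg: "\<And>\<omega> z1 z2. 0 \<le> s \<omega> z1 * s \<omega> z2"
  shows "positive_definite_kernel (spectral_kernel p)"
  unfolding positive_definite_kernel_def
proof (intro allI impI)
  fix n :: nat and c :: "nat \<Rightarrow> real" and z :: "nat \<Rightarrow> real ^ 'd"
  define e where "e \<omega> v = exp (\<i> * complex_of_real (\<omega> \<bullet> v))" for \<omega> v :: "real ^ 'd"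
  \<comment> \<open>The summands of \<open>g\<close>.\<close>
  define a where "a \<omega> i = complex_of_real (c i * s \<omega> (z i)) * e \<omega> (z i)" for \<omega> i
  \<comment> \<open>The exponent is purely imaginary, so the inverse of \<open>e \<omega> w\<close>
    is its conjugate.\<close>
  have e_diff: "e \<omega> (v - w) = e \<omega> v * cnj (e \<omega> w)" for \<omega> v w
    by (simp add: e_def inner_diff_right right_diff_distrib exp_diff exp_minus divide_inverse exp_cnj)
  have int: "integrable lebesgue (\<lambda>\<omega>. complex_of_real (p \<omega> z1 z2) * e \<omega> (z1 - z2))" for z1 z2
    unfolding e_def using density[of z1 z2]
    by (intro integrable_mult_exp_inner) (simp add: prob_density_def)
  \<comment> \<open>Linearity of the Bochner integral requires each term to be integrable, which
    \<open>int\<close> supplies.\<close>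
  have "(\<Sum>i=1..n. \<Sum>k=1..n. complex_of_real (c i) * complex_of_real (c k)
            * spectral_kernel p (z i) (z k))
      = (LINT \<omega>|lebesgue. (\<Sum>i=1..n. \<Sum>k=1..n. complex_of_real (c i) * complex_of_real (c k)
            * (complex_of_real (p \<omega> (z i) (z k)) * e \<omega> (z i - z k))))"
    unfolding spectral_kernel_def e_def[symmetric]
    by (simp only: int Bochner_Integration.integral_sum Bochner_Integration.integrable_sum
        integrable_mult_right integral_mult_right_zero)
  \<comment> \<open>As \<open>c\<close> and \<open>s\<close> are real, conjugating
    \<open>a \<omega> k\<close> affects only its exponential factor.\<close>
  also have "\<dots> = (LINT \<omega>|lebesgue. complex_of_real (r \<omega>)
      * (\<Sum>i=1..n. \<Sum>k=1..n. a \<omega> i * cnj (a \<omega> k)))"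
    by (simp add: a_def factor e_diff sum_distrib_left mult_ac)
  \<comment> \<open>The quadratic form is now the embedding of a real integral, so its imaginary
    part vanishes and only the sign of the integrand is left to check.\<close>
  also have "\<dots> = complex_of_real (LINT \<omega>|lebesgue. r \<omega> * (cmod (\<Sum>i=1..n. a \<omega> i))\<^sup>2)"
    by (simp only: double_sum_cnj_eq_norm_square of_real_mult[symmetric] integral_complex_of_real)
  also have "\<dots> \<in> \<real>\<^sub>\<ge>\<^sub>0"
    using r_nonneg
    by (simp only: nonneg_Reals_of_real_iff)
      (intro Bochner_Integration.integral_nonneg, simp)
  finally show "(\<Sum>i=1..n. \<Sum>k=1..n. complex_of_real (c i) * complex_of_real (c k)
      * spectral_kernel p (z i) (z k)) \<in> \<real>\<^sub>\<ge>\<^sub>0" .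
qed

end
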